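(* Let $X=(X_n)_{n\in\mathbb{Z}}$ be the i.i.d. increments of a skip-free to the left random walk with $\mathbb{E}[X_0]=0$. Then the map $R_\perp$ preserves the distribution of $X$, i.e. $[\mathbb{Z},R_\perp(0),X]\overset{\mathcal{D}}{=}[\mathbb{Z},0,X]$; equivalently, the shifted sequence $(X_{n+R_\perp(0)})_{n\in\mathbb{Z}}$ has the same distribution as $(X_n)_{n\in\mathbb{Z}}$.
   Context: **Increments.** "I.i.d. increments of a skip-free to the left random walk" means: $X=(X_n)_{n\in\mathbb{Z}}$ is i.i.d., each $X_n$ takes values in $\{-1,0,1,2,\dots\}$, $\mathbb{P}[X_0=-1]>0$ and $\mathbb{E}[X_0]<\infty$. **Network.** $[\mathbb{Z},i,x]$ denotes the equivalence class, up to order-preserving (i.e. translation) isomorphism of $\mathbb{Z}$, of the line $\mathbb{Z}$ rooted at $i$ with mark $x_n$ on the edge $(n,n+1)$; it is identified with the sequence $(x_{n+i})_{n\in\mathbb{Z}}$. **Record map and $R_\perp$.** The record map of $x$ is $R_x(i)=\inf\{j>i:\sum_{l=i}^{j-1}x_l\ge 0\}$ if the infimum exists and $R_x(i)=i$ otherwise; $R_x^n$ is its $n$-th iterate. The random map $R_\perp:\mathbb{Z}\to\mathbb{Z}$ is $$R_\perp(i)=\inf\{k>i: R_X^n(i)=R_X^n(k)\text{ for some }n\ge1\}$$ if the infimum exists, and $R_\perp(i)=i$ otherwise. *)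

theory Defs
  imports "HOL-Probability.Probability"
begin

(* Measurability is included because distr is a junk value on non-measurable maps. *)
definition same_distribution ::
    "'a measure \<Rightarrow> 'b measure \<Rightarrow> ('a \<Rightarrow> 'b) \<Rightarrow> ('a \<Rightarrow> 'b) \<Rightarrow> bool" where
  "same_distribution M N Y Z \<longleftrightarrow>
     Y \<in> measurable M N \<and> Z \<in> measurable M N \<and> distr M N Y = distr M N Z"

(* As X 0 is bounded below, integrability says exactly that its expectation,
   which always exists in (-infinity, infinity], is finite. *)
definition skip_free_left_increments :: "'a measure \<Rightarrow> (int \<Rightarrow> 'a \<Rightarrow> int) \<Rightarrow> bool" where
  "skip_free_left_increments M X \<longleftrightarrow>
     prob_space.indep_vars M (\<lambda>_. count_space UNIV) X UNIV \<and>
     (\<forall>n. same_distribution M (count_space UNIV) (X n) (X 0)) \<and>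
     (\<forall>n. AE \<omega> in M. X n \<omega> \<ge> -1) \<and>
     measure M {\<omega> \<in> space M. X 0 \<omega> = -1} > 0 \<and>
     integrable M (\<lambda>\<omega>. real_of_int (X 0 \<omega>))"

(* In both definitions below the set is bounded below by i, so its infimum exists
   (and is its least element) exactly when the set is nonempty. *)
definition record_map :: "(int \<Rightarrow> int) \<Rightarrow> int \<Rightarrow> int" where
  "record_map x i =
     (let J = {j. j > i \<and> (\<Sum>l\<in>{i..<j}. x l) \<ge> 0}
      in if J \<noteq> {} then Inf J else i)"

definition R_perp :: "(int \<Rightarrow> int) \<Rightarrow> int \<Rightarrow> int" where
  "R_perp x i =
     (let K = {k. k > i \<and> (\<exists>n\<ge>1. (record_map x ^^ n) i = (record_map x ^^ n) k)}
      in if K \<noteq> {} then Inf K else i)"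

(* The isomorphism class [Z, i, x] of the line rooted at i, in its identification
   with the sequence of marks seen from the root. *)
definition rooted_line :: "int \<Rightarrow> (int \<Rightarrow> int) \<Rightarrow> int \<Rightarrow> int" where
  "rooted_line i x = (\<lambda>n. x (n + i))"

end

theory Submission
  imports Defs
begin

text \<open>
  Write \<open>R\<close> for the record map. The mean-zero walk oscillates, so almost surely \<open>R\<close> moves every
  integer to the right, and some earlier partial sum exceeds the one at \<open>0\<close>. As \<open>R ^^ n\<close> sends
  \<open>k\<close> to \<open>0\<close> only if all partial sums in between are at most the one at \<open>0\<close>, the probability
  that \<open>0\<close> has a preimage under \<open>R ^^ n\<close> tends to \<open>0\<close>.

  Let every integer that is the last one of its fibre of \<open>R ^^ n\<close> send unit mass to its image.
  By the mass transport principle, the probability that \<open>0\<close> is the last of its fibre is at most the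
  probability that \<open>0\<close> has a preimage under \<open>R ^^ n\<close>. Letting \<open>n\<close> grow, almost surely
  \<open>R_perp\<close> moves every integer to the right, and therefore it is injective.

  Finally, mass transport along an injective equivariant map shows that the law of the sequence seen
  from the image of \<open>0\<close> is dominated by the original law. Both are probability measures, so they
  agree.
\<close>

section \<open>Mean-zero integer walks: almost sure descent below zero\<close>

text \<open>Meant for \<open>h k\<close> the probability that the walk with steps \<open>f\<close>
  started at \<open>k\<close> never becomes negative.\<close>

lemma (in prob_space) mono_bounded_harmonic_zero:
  fixes f :: "'a \<Rightarrow> int" and h :: "int \<Rightarrow> real"
  assumes f: "f \<in> measurable M (count_space UNIV)"
    and int: "integrable M (\<lambda>x. real_of_int (f x))"
    and mean: "(\<integral>x. real_of_int (f x) \<partial>M) = 0"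
    and pos: "\<not> (AE x in M. f x \<le> 0)"
    and "mono h"
    and h_neg: "\<And>k. k < 0 \<Longrightarrow> h k = 0"
    and h_le: "\<And>k. h k \<le> 1"
    and harm: "\<And>k. k \<ge> 0 \<Longrightarrow> h k = (\<integral>x. h (k + f x) \<partial>M)"
  shows "h 0 = 0"
proof -
  note [measurable] = f
  have h_ge: "0 \<le> h k" for k
    using monoD[OF \<open>mono h\<close>, of "-1" k] h_neg[of k] h_neg[of "-1"] by (cases "k < 0") auto
  \<comment> \<open>Summing the harmonic equation over \<open>k < N\<close> telescopes. As \<open>N\<close> grows, the terms at the
    upper end contribute \<open>H\<close> times the mean, that is nothing, so those at \<open>0\<close> vanish too.\<close>
  define G where "G = (\<lambda>(N::nat) y. \<Sum>k<N. h (int k + y))"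
  have step: "G N (y + 1) - G N y = h (int N + y) - h y" for N y
    using sum_lessThan_telescope[of "\<lambda>k. h (int k + y)" N]
    by (simp add: G_def sum_subtractf[symmetric] algebra_simps)
  have up: "G N (int b) - G N 0 = (\<Sum>i<b. h (int N + int i) - h (int i))" for N b
  proof (induction b)
    case (Suc b)
    then show ?case using step[of N "int b"] by (simp add: algebra_simps)
  qed simp
  have down: "G N (- int b) - G N 0 = - (\<Sum>i<b. h (int N - int i - 1))" for N b
  proof (induction b)
    case (Suc b)
    have "h (- 1 - int b) = 0" by (rule h_neg) simp
    then show ?case using Suc step[of N "- 1 - int b"] by (simp add: algebra_simps)
  qed simp
  define H where "H = (SUP n. h (int n))"
  have "(\<lambda>n. h (int n)) \<longlonglongrightarrow> H"
    unfolding H_def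
    by (rule LIMSEQ_incseq_SUP) (auto intro!: bdd_aboveI[of _ 1] monoI monoD[OF \<open>mono h\<close>] simp: h_le)
  moreover have "filterlim (\<lambda>N. nat (int N + c)) sequentially sequentially" for c
    unfolding filterlim_at_top
  proof
    fix Z show "\<forall>\<^sub>F N in sequentially. Z \<le> nat (int N + c)"
      using eventually_ge_at_top[of "Z + nat (- c)"] by eventually_elim auto
  qed
  ultimately have "(\<lambda>N. h (int (nat (int N + c)))) \<longlonglongrightarrow> H" for c
    by (rule filterlim_compose)
  moreover have "\<forall>\<^sub>F N in sequentially. h (int (nat (int N + c))) = h (int N + c)" for c
    using eventually_ge_at_top[of "nat (- c)"] by eventually_elim auto
  ultimately have lim: "(\<lambda>N. h (int N + c)) \<longlonglongrightarrow> H" for c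
    by (rule Lim_transform_eventually)
  \<comment> \<open>For \<open>y < 0\<close> the sum is empty since \<open>nat y = 0\<close>,
    matching \<open>h\<close> being zero below \<open>0\<close>; one formula covers both
    signs.\<close>
  define L where "L = (\<lambda>y. H * real_of_int y - (\<Sum>i<nat y. h (int i)))"
  have D_lim: "(\<lambda>N. G N y - G N 0) \<longlonglongrightarrow> L y" for y
  proof (cases "y \<ge> 0")
    case True
    have "(\<lambda>N. \<Sum>i<nat y. h (int N + int i) - h (int i)) \<longlonglongrightarrow> (\<Sum>i<nat y. H - h (int i))"
      by (intro tendsto_intros lim)
    then show ?thesis using True up[of _ "nat y"] by (simp add: L_def sum_subtractf mult.commute)
  next
    case False
    have "(\<lambda>N. h (int N - int i - 1)) \<longlonglongrightarrow> H" for i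
      using lim[of "- int i - 1"] by (simp add: algebra_simps)
    then have "(\<lambda>N. - (\<Sum>i<nat (- y). h (int N - int i - 1))) \<longlonglongrightarrow> - (\<Sum>i<nat (- y). H)"
      by (intro tendsto_intros)
    then show ?thesis using False down[of _ "nat (- y)"] by (simp add: L_def mult.commute)
  qed
  \<comment> \<open>Up to sign the difference is a sum of \<open>\<bar>y\<bar>\<close> terms of size
    at most \<open>1\<close>. This makes \<open>\<bar>f x\<bar>\<close> an integrable bound,
    uniformly in \<open>N\<close>.\<close>
  have D_bound: "\<bar>G N y - G N 0\<bar> \<le> \<bar>real_of_int y\<bar>" for N y
  proof (cases "y \<ge> 0")
    case True
    have "\<bar>\<Sum>i<nat y. h (int N + int i) - h (int i)\<bar> \<le> (\<Sum>i<nat y. 1)"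
      by (rule order.trans[OF sum_abs], rule sum_mono)
        (smt (verit) h_ge h_le)
    then show ?thesis using True up[of _ "nat y"] by simp
  next
    case False
    have "\<bar>\<Sum>i<nat (- y). h (int N - int i - 1)\<bar> \<le> (\<Sum>i<nat (- y). 1)"
      by (rule order.trans[OF sum_abs], rule sum_mono)
        (smt (verit) h_ge h_le)
    then show ?thesis using False down[of _ "nat (- y)"] by simp
  qed
  have h_int: "integrable M (\<lambda>x. h (k + f x))" for k
    by (rule integrable_const_bound[of _ 1]) (use h_ge h_le in auto)
  have D_zero: "(\<integral>x. G N (f x) - G N 0 \<partial>M) = 0" for N
    by (simp add: G_def h_int prob_space harm[symmetric])
  have "(\<lambda>N. \<integral>x. G N (f x) - G N 0 \<partial>M) \<longlonglongrightarrow> (\<integral>x. L (f x) \<partial>M)"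
    by (rule integral_dominated_convergence[where w = "\<lambda>x. \<bar>real_of_int (f x)\<bar>"])
      (use int D_lim D_bound in auto)
  then have L_zero: "(\<integral>x. L (f x) \<partial>M) = 0"
    using D_zero by (simp add: LIMSEQ_const_iff)
  have L_int: "integrable M (\<lambda>x. L (f x))"
    by (rule integrable_dominated_convergence[where w = "\<lambda>x. \<bar>real_of_int (f x)\<bar>"
          and s = "\<lambda>N x. G N (f x) - G N 0"])
      (use int D_lim D_bound in auto)
  let ?s = "\<lambda>x. \<Sum>i<nat (f x). h (int i)"
  have "?s x = H * real_of_int (f x) - L (f x)" for x
    by (simp add: L_def)
  then have "integrable M ?s" "(\<integral>x. ?s x \<partial>M) = 0"
    using int L_int L_zero mean by simp_all
  \<comment> \<open>The boundary sum is nonnegative, and wherever \<open>f x > 0\<close> it contains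
    the term \<open>h 0\<close>.\<close>
  then have "AE x in M. ?s x = 0"
    using integral_nonneg_eq_0_iff_AE[of M ?s] by (auto simp: sum_nonneg h_ge)
  then have "AE x in M. f x \<le> 0" if "h 0 > 0"
  proof eventually_elim
    case (elim x)
    have "h (int i) = 0" if "i < nat (f x)" for i
      using elim that by (subst (asm) sum_nonneg_eq_0_iff) (auto simp: h_ge)
    from this[of 0] \<open>h 0 > 0\<close> show ?case by (cases "f x \<le> 0") auto
  qed
  with pos h_ge[of 0] show ?thesis by force
qed

lemma measurable_add_countable:
  fixes f g :: "'a \<Rightarrow> 'b::{countable, plus}"
  assumes "f \<in> measurable M (count_space UNIV)" "g \<in> measurable M (count_space UNIV)"
  shows "(\<lambda>x. f x + g x) \<in> measurable M (count_space UNIV)"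
  by (rule measurable_compose_countable[OF _ assms(1), where f = "\<lambda>i x. i + g x"])
    (rule measurable_compose[OF assms(2)], simp)

lemma measurable_sum_countable:
  fixes f :: "'i \<Rightarrow> 'a \<Rightarrow> 'b::{countable, comm_monoid_add}"
  assumes "\<And>i. i \<in> I \<Longrightarrow> f i \<in> measurable M (count_space UNIV)"
  shows "(\<lambda>x. \<Sum>i\<in>I. f i x) \<in> measurable M (count_space UNIV)"
  using assms by (induction I rule: infinite_finite_induct) (simp_all add: measurable_add_countable)

text \<open>First-step analysis: the probability of \<open>A k\<close>, that the walk started at
  \<open>k\<close> never goes negative, is harmonic for \<open>k \<ge> 0\<close>, so
  \<open>A 0\<close> is null.\<close>

lemma (in sequence_space) AE_walk_below_zero:
  fixes f :: "'a \<Rightarrow> int"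
  assumes f [measurable]: "f \<in> measurable M (count_space UNIV)"
    and int: "integrable M (\<lambda>x. real_of_int (f x))"
    and mean: "(\<integral>x. real_of_int (f x) \<partial>M) = 0"
    and pos: "\<not> (AE x in M. f x \<le> 0)"
  shows "AE x in S. \<exists>m. (\<Sum>i<m. f (x i)) < 0"
proof -
  define A where "A = (\<lambda>k. {x \<in> space S. \<forall>m. 0 \<le> k + (\<Sum>i<m. f (x i))})"
  have [measurable]: "Measurable.pred S (\<lambda>x. 0 \<le> k + (\<Sum>i<m. f (x i)))" for k m
    by (rule measurable_compose[where g = "\<lambda>s. 0 \<le> k + s", OF measurable_sum_countable])
      (use measurable_compose[OF measurable_component_singleton[of _ UNIV "\<lambda>_. M"] f] in auto)
  have A [measurable]: "A k \<in> sets S" for k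
    unfolding A_def by measurable
  define h where "h = (\<lambda>k. measure S (A k))"
  have "h 0 = 0"
  proof (rule M.mono_bounded_harmonic_zero[OF f int mean pos])
    show "mono h"
    proof (rule monoI)
      fix k l :: int
      assume "k \<le> l"
      then have "A k \<subseteq> A l"
        by (auto simp: A_def intro: order.trans[OF _ add_right_mono])
      then show "h k \<le> h l" unfolding h_def by (intro finite_measure_mono) auto
    qed
    show "h k = 0" if "k < 0" for k
    proof -
      have "A k = {}" using that by (auto simp: A_def intro!: exI[of _ 0])
      then show ?thesis by (simp add: h_def)
    qed
    show "h k \<le> 1" for k by (simp add: h_def)
    show "h k = (\<integral>x. h (k + f x) \<partial>M)" if "k \<ge> 0" for k
    proof -
      \<comment> \<open>For \<open>m = 0\<close> the condition is just \<open>0 \<le> k\<close>,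
        which holds here; all later ones pass to the tail started at \<open>k + f s\<close>.\<close>
      have mem: "case_nat s x \<in> A k \<longleftrightarrow> x \<in> A (k + f s)" if "s \<in> space M" "x \<in> space S" for s x
      proof -
        have "(\<forall>m. 0 \<le> k + (\<Sum>i<m. f (case_nat s x i))) \<longleftrightarrow> (\<forall>m. 0 \<le> k + f s + (\<Sum>i<m. f (x i)))"
          (is "(\<forall>m. ?P m) \<longleftrightarrow> (\<forall>m. ?Q m)")
        proof -
          have "?P (Suc m) \<longleftrightarrow> ?Q m" for m
            by (simp add: sum.lessThan_Suc_shift algebra_simps del: sum.lessThan_Suc)
          moreover have "?P 0" using \<open>k \<ge> 0\<close> by simp
          ultimately show ?thesis by (metis not0_implies_Suc)
        qed
        then show ?thesis using that
          by (auto simp: A_def space_PiM PiE_iff split: nat.split)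
      qed
      have [measurable]: "(\<lambda>(s, x). case_nat s x) \<in> measurable (M \<Otimes>\<^sub>M S) S"
        by measurable
      \<comment> \<open>Prepending an independent step leaves the i.i.d. law unchanged; this first
        step is then integrated out.\<close>
      have "emeasure S (A k) = emeasure (distr (M \<Otimes>\<^sub>M S) S (\<lambda>(s, x). case_nat s x)) (A k)"
        by (simp add: PiM_iter)
      also have "\<dots> = emeasure (M \<Otimes>\<^sub>M S) ((\<lambda>(s, x). case_nat s x) -` A k \<inter> space (M \<Otimes>\<^sub>M S))"
        by (rule emeasure_distr) auto
      also have "\<dots> = (\<integral>\<^sup>+s. emeasure S (Pair s -` ((\<lambda>(s, x). case_nat s x) -` A k \<inter> space (M \<Otimes>\<^sub>M S))) \<partial>M)"
        by (rule emeasure_pair_measure_alt) measurable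
      also have "\<dots> = (\<integral>\<^sup>+s. ennreal (h (k + f s)) \<partial>M)"
      proof (rule nn_integral_cong)
        fix s assume "s \<in> space M"
        have "Pair s -` ((\<lambda>(s, x). case_nat s x) -` A k \<inter> space (M \<Otimes>\<^sub>M S)) = A (k + f s)"
        proof (rule set_eqI)
          fix x
          have "x \<in> A (k + f s) \<Longrightarrow> x \<in> space S" by (simp only: A_def mem_Collect_eq)
          then show "x \<in> Pair s -` ((\<lambda>(s, x). case_nat s x) -` A k \<inter> space (M \<Otimes>\<^sub>M S)) \<longleftrightarrow> x \<in> A (k + f s)"
            using mem[OF \<open>s \<in> space M\<close>, of x] \<open>s \<in> space M\<close>
            by (simp only: space_pair_measure vimage_eq Int_iff mem_Times_iff fst_conv snd_conv prod.case) blast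
        qed
        then show "emeasure S (Pair s -` ((\<lambda>(s, x). case_nat s x) -` A k \<inter> space (M \<Otimes>\<^sub>M S))) = ennreal (h (k + f s))"
          by (simp add: h_def emeasure_eq_measure)
      qed
      also have "\<dots> = ennreal (\<integral>s. h (k + f s) \<partial>M)"
        by (rule nn_integral_eq_integral)
          (auto simp: h_def intro!: M.integrable_const_bound[of _ 1])
      finally show ?thesis
        by (simp add: h_def emeasure_eq_measure Bochner_Integration.integral_nonneg)
    qed
  qed
  then have "A 0 \<in> null_sets S"
    by (simp add: h_def emeasure_eq_measure null_sets_def)
  then show ?thesis
    by (rule AE_I') (auto simp: A_def not_less)
qed

section \<open>Pathwise properties of the record map and of \<open>R_perp\<close>\<close>

text \<open>Removes the infimum from both definitions, leaving quantifiers over integers;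
  measurability and equivariance are checked in this form. It holds because a nonempty set of
  integers bounded below attains its infimum.\<close>

lemma Inf_next_int_eq_iff:
  fixes i j :: int
  shows "(if {k. k > i \<and> P k} \<noteq> {} then Inf {k. k > i \<and> P k} else i) = j \<longleftrightarrow>
    (if j > i then P j \<and> (\<forall>k. i < k \<and> k < j \<longrightarrow> \<not> P k) else j = i \<and> (\<forall>k>i. \<not> P k))"
proof (cases "\<exists>k>i. P k")
  case True
  then obtain a where a: "i < a" "P a" by blast
  define d where "d = (LEAST d. P (i + 1 + int d))"
  define m where "m = i + 1 + int d"
  have "P (i + 1 + int (nat (a - i - 1)))" using a by simp
  then have "P m" unfolding m_def d_def by (rule LeastI)
  have min: "m \<le> k" if "k > i" "P k" for k
  proof -
    have "P (i + 1 + int (nat (k - i - 1)))" using that by simp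
    then have "d \<le> nat (k - i - 1)" unfolding d_def by (rule Least_le)
    then show ?thesis using that by (simp add: m_def)
  qed
  have "m > i" by (simp add: m_def)
  then have "Inf {k. k > i \<and> P k} = m"
    using \<open>P m\<close> min by (intro cInf_eq_minimum) auto
  then show ?thesis
    using \<open>m > i\<close> \<open>P m\<close> min True by (auto simp: not_less[symmetric]) (metis linorder_cases)+
next
  case False
  then show ?thesis by auto
qed

lemma record_map_eq_iff:
  "record_map x i = j \<longleftrightarrow>
    (if j > i then 0 \<le> (\<Sum>l\<in>{i..<j}. x l) \<and> (\<forall>k. i < k \<and> k < j \<longrightarrow> (\<Sum>l\<in>{i..<k}. x l) < 0)
     else j = i \<and> (\<forall>k>i. (\<Sum>l\<in>{i..<k}. x l) < 0))"
  unfolding record_map_def Let_def Inf_next_int_eq_iff by (simp add: not_le)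

lemma R_perp_eq_iff:
  "R_perp x i = j \<longleftrightarrow>
    (if j > i then (\<exists>n\<ge>1. (record_map x ^^ n) i = (record_map x ^^ n) j) \<and>
       (\<forall>k. i < k \<and> k < j \<longrightarrow> \<not> (\<exists>n\<ge>1. (record_map x ^^ n) i = (record_map x ^^ n) k))
     else j = i \<and> (\<forall>k>i. \<not> (\<exists>n\<ge>1. (record_map x ^^ n) i = (record_map x ^^ n) k)))"
  unfolding R_perp_def Let_def Inf_next_int_eq_iff ..

lemma record_map_ge: "i \<le> record_map x i"
  using record_map_eq_iff[of x i "record_map x i"] by (auto split: if_splits)

lemma record_map_greater:
  assumes "j > i" "0 \<le> (\<Sum>l\<in>{i..<j}. x l)"
  shows "record_map x i > i"
  using assms record_map_eq_iff[of x i i] record_map_ge[of i x] by fastforce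

lemma sum_ivl_split_int:
  fixes x :: "int \<Rightarrow> int"
  assumes "a \<le> b" "b \<le> c"
  shows "(\<Sum>l\<in>{a..<c}. x l) = (\<Sum>l\<in>{a..<b}. x l) + (\<Sum>l\<in>{b..<c}. x l)"
proof -
  have "{a..<c} = {a..<b} \<union> {b..<c}" using assms by auto
  then show ?thesis by (simp add: sum.union_disjoint)
qed

text \<open>Strictly between \<open>i\<close> and its record the sums from \<open>i\<close> are
  negative, while at the record the sum is nonnegative; subtract. Without a record the sum is
  empty.\<close>

lemma sum_to_record_nonneg:
  assumes "i \<le> l" "l \<le> record_map x i"
  shows "0 \<le> (\<Sum>k\<in>{l..<record_map x i}. x k)"
proof (cases "i < record_map x i")
  case True
  with record_map_eq_iff[of x i "record_map x i"]
  have 1: "0 \<le> (\<Sum>k\<in>{i..<record_map x i}. x k)"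
    and 2: "\<And>k. i < k \<Longrightarrow> k < record_map x i \<Longrightarrow> (\<Sum>l\<in>{i..<k}. x l) < 0" by auto
  show ?thesis
  proof (cases "i < l \<and> l < record_map x i")
    case True
    then show ?thesis
      using 1 2[of l] sum_ivl_split_int[of i l "record_map x i" x] assms by auto
  next
    case False
    then have "l = i \<or> l = record_map x i" using assms by auto
    then show ?thesis using 1 by auto
  qed
next
  case False
  then show ?thesis using assms by simp
qed

text \<open>If \<open>l\<close> is at or before the start \<open>?m\<close> of the last jump, the
  sum splits there into two nonnegative ones; otherwise only the last jump matters.\<close>

lemma sum_to_iterated_record_nonneg:
  assumes "i \<le> l" "l \<le> (record_map x ^^ n) i"
  shows "0 \<le> (\<Sum>k\<in>{l..<(record_map x ^^ n) i}. x k)"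
  using assms
proof (induction n)
  case (Suc n)
  let ?m = "(record_map x ^^ n) i"
  have m: "?m \<le> record_map x ?m" by (rule record_map_ge)
  show ?case
  proof (cases "l \<le> ?m")
    case True
    then show ?thesis
      using Suc sum_to_record_nonneg[of ?m ?m x] sum_ivl_split_int[OF True m, of x] m by auto
  next
    case False
    then show ?thesis using Suc.prems sum_to_record_nonneg[of ?m l x] by auto
  qed
qed simp

lemma iterated_record_ge:
  assumes "\<And>i. record_map x i > i"
  shows "i + int n \<le> (record_map x ^^ n) i"
proof (induction n)
  case (Suc n)
  then show ?case using assms[of "(record_map x ^^ n) i"] by simp
qed simp

text \<open>Each jump advances by at least one, so a preimage \<open>k\<close> would lie at or to
  the left of \<open>l\<close>, and the sum from \<open>l\<close> to \<open>i\<close> could not be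
  negative.\<close>

lemma no_iterated_record_before:
  assumes "\<And>i. record_map x i > i"
    and "l < i" "(\<Sum>k\<in>{l..<i}. x k) < 0" "int n \<ge> i - l"
  shows "(record_map x ^^ n) k \<noteq> i"
proof
  assume eq: "(record_map x ^^ n) k = i"
  have "k + int n \<le> i" using iterated_record_ge[OF assms(1), of k n] eq by simp
  then have "k \<le> l" using assms(4) by simp
  then show False using sum_to_iterated_record_nonneg[of k l n x] assms(2,3) eq by simp
qed

lemma funpow_eq_mono:
  fixes f :: "'a \<Rightarrow> 'a"
  assumes "(f ^^ n) a = (f ^^ n) b" "n \<le> m"
  shows "(f ^^ m) a = (f ^^ m) b"
proof -
  have "f ^^ m = f ^^ (m - n) \<circ> f ^^ n" using assms(2) by (simp flip: funpow_add)
  then show ?thesis using assms(1) by simp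
qed

text \<open>If \<open>i < j\<close> had the same image, their orbits would merge, so
  \<open>j\<close> would be a candidate for the infimum at \<open>i\<close>. Then
  \<open>R_perp x i \<le> j < R_perp x j\<close>.\<close>

lemma R_perp_inj:
  assumes gt: "\<And>i. R_perp x i > i"
  shows "inj (R_perp x)"
proof -
  have "R_perp x i \<noteq> R_perp x j" if "i < j" for i j
  proof
    assume eq: "R_perp x i = R_perp x j"
    have "\<exists>n\<ge>1. (record_map x ^^ n) k = (record_map x ^^ n) (R_perp x k)" for k
      using R_perp_eq_iff[of x k "R_perp x k"] gt[of k] by simp
    then obtain n m where nm: "n \<ge> 1" "(record_map x ^^ n) i = (record_map x ^^ n) (R_perp x i)"
       "(record_map x ^^ m) j = (record_map x ^^ m) (R_perp x i)"
      using eq by metis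
    have "(record_map x ^^ max n m) i = (record_map x ^^ max n m) j"
      using funpow_eq_mono[OF nm(2), of "max n m"] funpow_eq_mono[OF nm(3), of "max n m"] by simp
    moreover have "max n m \<ge> 1" using nm(1) by simp
    ultimately have "R_perp x i \<le> j"
      using R_perp_eq_iff[of x i "R_perp x i"] gt[of i] that by (meson not_le)
    then show False using eq gt[of j] by simp
  qed
  then show ?thesis by (metis injI linorder_neqE)
qed

section \<open>Shift equivariance and measurability\<close>

lemma rooted_line_0 [simp]: "rooted_line 0 x = x"
  by (simp add: rooted_line_def)

lemma rooted_line_rooted_line [simp]: "rooted_line a (rooted_line b x) = rooted_line (a + b) x"
  by (simp add: rooted_line_def add.assoc)

lemma sum_shift_int:
  fixes x :: "int \<Rightarrow> int"
  shows "(\<Sum>l\<in>{i..<k}. x (l + m)) = (\<Sum>l\<in>{i + m..<k + m}. x l)"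
  by (rule sum.reindex_bij_witness[of _ "\<lambda>l. l - m" "\<lambda>l. l + m"]) auto

lemma record_map_rooted_line: "record_map (rooted_line m x) i = record_map x (i + m) - m"
  unfolding record_map_eq_iff[of "rooted_line m x"]
  unfolding rooted_line_def sum_shift_int
  using record_map_eq_iff[of x "i + m" "record_map x (i + m)"] by (auto split: if_splits)

lemma iterated_record_rooted_line:
  "(record_map (rooted_line m x) ^^ n) i = (record_map x ^^ n) (i + m) - m"
  by (induction n) (simp_all add: record_map_rooted_line)

lemma R_perp_rooted_line: "R_perp (rooted_line m x) i = R_perp x (i + m) - m"
proof -
  show ?thesis
    unfolding R_perp_eq_iff[of "rooted_line m x"] iterated_record_rooted_line
    using R_perp_eq_iff[of x "i + m" "R_perp x (i + m)"]
    by (auto split: if_splits)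
qed

abbreviation int_seq :: "(int \<Rightarrow> int) measure" where
  "int_seq \<equiv> \<Pi>\<^sub>M n\<in>UNIV. count_space UNIV"

lemma measurable_partial_sum [measurable]:
  "(\<lambda>x. \<Sum>l\<in>A. x l) \<in> measurable int_seq (count_space UNIV)"
  by (rule measurable_sum_countable) simp

lemma measurable_record_map [measurable]:
  "(\<lambda>x. record_map x i) \<in> measurable int_seq (count_space UNIV)"
proof -
  have [measurable]: "Measurable.pred int_seq (\<lambda>x. 0 \<le> (\<Sum>l\<in>A. x l))"
    "Measurable.pred int_seq (\<lambda>x. (\<Sum>l\<in>A. x l) < 0)" for A
    by (rule measurable_compose[OF measurable_partial_sum], simp)+
  have "{x \<in> space int_seq. record_map x i = j} \<in> sets int_seq" for j
    unfolding record_map_eq_iff by measurable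
  then show ?thesis
    by (subst measurable_count_space_eq2_countable) (auto simp: vimage_def Int_def conj_commute)
qed

text \<open>The next iterate evaluates \<open>record_map\<close> at a random place, which takes only
  countably many values.\<close>

lemma measurable_iterated_record [measurable]:
  "(\<lambda>x. (record_map x ^^ n) i) \<in> measurable int_seq (count_space UNIV)"
proof (induction n)
  case (Suc n)
  show ?case
    using measurable_compose_countable[OF measurable_record_map Suc] by simp
qed simp

lemma measurable_R_perp [measurable]:
  "(\<lambda>x. R_perp x i) \<in> measurable int_seq (count_space UNIV)"
proof -
  have "{x \<in> space int_seq. R_perp x i = j} \<in> sets int_seq" for j
    unfolding R_perp_eq_iff by measurable
  then show ?thesis
    by (subst measurable_count_space_eq2_countable) (auto simp: vimage_def Int_def conj_commute)
qed

lemma measurable_rooted_line [measurable]: "rooted_line m \<in> measurable int_seq int_seq"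
  unfolding rooted_line_def by (rule measurable_PiM_single') (auto simp: space_PiM)

lemma measurable_shift_R_perp [measurable]:
  "(\<lambda>x. rooted_line (R_perp x 0) x) \<in> measurable int_seq int_seq"
  by (rule measurable_compose_countable) measurable

section \<open>Stationary sequences and mass transport\<close>

text \<open>Only the sigma-algebra is tied to \<open>int_seq\<close>, so that products of a step law
  on the integers fit.\<close>

locale stationary_sequence = prob_space P for P :: "(int \<Rightarrow> int) measure" +
  assumes sets_P [measurable_cong]: "sets P = sets int_seq"
    and distr_shift: "distr P P (rooted_line m) = P"
begin

lemma space_P [simp]: "space P = UNIV"
  using sets_eq_imp_space_eq[OF sets_P] by (simp add: space_PiM)

lemma AE_shift:
  assumes "AE x in P. Q x"
  shows "AE x in P. \<forall>m. Q (rooted_line m x)"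
proof -
  have "AE x in distr P P (rooted_line m). Q x" for m
    using assms by (simp only: distr_shift)
  then have "AE x in P. Q (rooted_line m x)" for m
    by (rule AE_distrD[rotated]) measurable
  then show ?thesis by (simp add: AE_all_countable)
qed

text \<open>Countable additivity for events disjoint up to a null set, with the sum over the
  integers written as an integral against counting measure.\<close>

lemma emeasure_ex_unique:
  fixes Q :: "(int \<Rightarrow> int) \<Rightarrow> int \<Rightarrow> bool"
  assumes [measurable]: "\<And>j. Measurable.pred P (\<lambda>x. Q x j)"
    and uniq: "AE x in P. \<forall>i j. Q x i \<longrightarrow> Q x j \<longrightarrow> i = j"
  shows "emeasure P {x. \<exists>j. Q x j} = (\<integral>\<^sup>+j. emeasure P {x. Q x j} \<partial>count_space UNIV)"
proof -
  have "Measurable.pred P (\<lambda>x. \<exists>j. Q x j)" by measurable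
  then have [measurable]: "{x. Q x j} \<in> sets P" "{x. \<exists>j. Q x j} \<in> sets P" for j
    using assms(1)[of j] by (simp_all add: pred_def)
  \<comment> \<open>These sets are disjoint outright and differ from the original events only by
    null sets.\<close>
  define C where "C = (\<lambda>j. {x. Q x j \<and> (\<forall>i. Q x i \<longrightarrow> i = j)})"
  have C [measurable]: "C j \<in> sets P" for j
  proof -
    have "Measurable.pred P (\<lambda>x. Q x j \<and> (\<forall>i. Q x i \<longrightarrow> i = j))" by measurable
    then show ?thesis by (simp add: pred_def C_def)
  qed
  have "(\<Union>j. C j) \<in> sets P"
    by (rule sets.countable_UN'') auto
  then have "emeasure P {x. \<exists>j. Q x j} = emeasure P (\<Union>j. C j)"
    using uniq by (intro emeasure_eq_AE) (auto simp: C_def elim!: eventually_mono)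
  also have "\<dots> = (\<integral>\<^sup>+j. emeasure P (C j) \<partial>count_space UNIV)"
    by (rule emeasure_UN_countable) (auto simp: disjoint_family_on_def C_def[abs_def] C[unfolded C_def])
  also have "\<dots> = (\<integral>\<^sup>+j. emeasure P {x. Q x j} \<partial>count_space UNIV)"
    using uniq
    by (intro nn_integral_cong emeasure_eq_AE) (auto simp: C_def C[unfolded C_def] elim!: eventually_mono)
  finally show ?thesis .
qed

text \<open>Read \<open>Q x i j\<close> as: \<open>i\<close> sends unit mass to \<open>j\<close>.
  The two sides are the expected masses sent and received at \<open>0\<close>; stationarity matches
  the mass from \<open>0\<close> to \<open>j\<close> with that from \<open>- j\<close> to
  \<open>0\<close>.\<close>

lemma mass_transport:
  fixes Q :: "(int \<Rightarrow> int) \<Rightarrow> int \<Rightarrow> int \<Rightarrow> bool"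
  assumes meas [measurable]: "\<And>i j. Measurable.pred P (\<lambda>x. Q x i j)"
    and equivariant: "\<And>m x i j. Q (rooted_line m x) i j \<longleftrightarrow> Q x (i + m) (j + m)"
    and out: "AE x in P. \<forall>i j. Q x 0 i \<longrightarrow> Q x 0 j \<longrightarrow> i = j"
    and into: "AE x in P. \<forall>i j. Q x i 0 \<longrightarrow> Q x j 0 \<longrightarrow> i = j"
  shows "emeasure P {x. \<exists>j. Q x 0 j} = emeasure P {x. \<exists>i. Q x i 0}"
proof -
  have shift: "emeasure P {x. Q x 0 j} = emeasure P {x. Q x (- j) 0}" for j
  proof -
    have "emeasure P {x. Q x (- j) 0} = emeasure (distr P P (rooted_line j)) {x. Q x (- j) 0}"
      by (simp add: distr_shift)
    also have "\<dots> = emeasure P {x. Q x 0 j}"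
      using meas[of "- j" 0] by (subst emeasure_distr) (simp_all add: pred_def vimage_def equivariant)
    finally show ?thesis ..
  qed
  have "emeasure P {x. \<exists>j. Q x 0 j} = (\<integral>\<^sup>+j. emeasure P {x. Q x (- j) 0} \<partial>count_space UNIV)"
    using out by (simp add: emeasure_ex_unique shift)
  also have "\<dots> = (\<integral>\<^sup>+i. emeasure P {x. Q x i 0} \<partial>count_space UNIV)"
    by (rule nn_integral_bij_count_space) (rule bij_uminus)
  also have "\<dots> = emeasure P {x. \<exists>i. Q x i 0}"
    using into by (simp add: emeasure_ex_unique)
  finally show ?thesis .
qed

end

section \<open>\<open>R_perp\<close> on oscillating sequences\<close>

text \<open>\<open>forward\<close> provides a record to the right of \<open>0\<close>;
  \<open>backward\<close> says that the walk was higher at some earlier time than at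
  \<open>0\<close>.\<close>

locale oscillating_sequence = stationary_sequence +
  assumes forward: "AE x in P. \<exists>j>0. 0 \<le> (\<Sum>l\<in>{0..<j}. x l)"
    and backward: "AE x in P. \<exists>l<0. (\<Sum>k\<in>{l..<0}. x k) < 0"
begin

lemma AE_record_map_greater: "AE x in P. \<forall>i. record_map x i > i"
  using AE_shift[OF forward]
proof eventually_elim
  case (elim x)
  show ?case
  proof
    fix i
    obtain j where "j > 0" "0 \<le> (\<Sum>l\<in>{0..<j}. rooted_line i x l)" using elim by blast
    then show "record_map x i > i"
      by (intro record_map_greater[of i "j + i"]) (simp_all add: rooted_line_def sum_shift_int)
  qed
qed

text \<open>Along almost every path \<open>backward\<close> supplies some \<open>l < 0\<close>, and
  no preimage exists once \<open>n \<ge> - l\<close>; dominated convergence passes from indicators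
  to probabilities.\<close>

lemma iterated_preimage_vanishes:
  "(\<lambda>n. prob {x. \<exists>k. (record_map x ^^ n) k = 0}) \<longlonglongrightarrow> 0"
proof -
  let ?G = "\<lambda>n. {x. \<exists>k. (record_map x ^^ n) k = 0}"
  have G [measurable]: "?G n \<in> sets P" for n
  proof -
    have "Measurable.pred P (\<lambda>x. \<exists>k. (record_map x ^^ n) k = 0)" by measurable
    then show ?thesis by (simp add: pred_def)
  qed
  have "(\<lambda>n. \<integral>x. indicator (?G n) x \<partial>P) \<longlonglongrightarrow> (\<integral>x. (0 :: real) \<partial>P)"
  proof (rule integral_dominated_convergence[where w = "\<lambda>_. 1"])
    show "AE x in P. (\<lambda>n. indicator (?G n) x :: real) \<longlonglongrightarrow> 0"
      using AE_record_map_greater backward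
    proof eventually_elim
      case (elim x)
      then obtain l where l: "l < 0" "(\<Sum>k\<in>{l..<0}. x k) < 0" by blast
      have "\<forall>\<^sub>F n in sequentially. indicator (?G n) x = (0 :: real)"
        using eventually_ge_at_top[of "nat (- l)"]
      proof eventually_elim
        case (elim n)
        then have "(record_map x ^^ n) k \<noteq> 0" for k
          using no_iterated_record_before[of x l 0 n k] l \<open>\<forall>i. i < record_map x i\<close> by simp
        then show ?case by simp
      qed
      then show ?case by (rule tendsto_eventually)
    qed
  qed auto
  then show ?thesis by simp
qed

text \<open>If \<open>R_perp x 0\<close> is not positive, then \<open>0\<close> is the last point of
  its fibre for every \<open>n \<ge> 1\<close>; \<open>last_le\<close> bounds the probability of
  this by one that tends to zero.\<close>

lemma AE_R_perp_greater: "AE x in P. \<forall>i. R_perp x i > i"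
proof -
  have pred_last: "Measurable.pred P (\<lambda>x. \<forall>k>i. (record_map x ^^ n) k \<noteq> (record_map x ^^ n) i)" for i n
    by measurable
  have set_last: "{x. \<forall>k>i. (record_map x ^^ n) k \<noteq> (record_map x ^^ n) i} \<in> sets P" for i n
    using pred_last[of i n] by (simp add: pred_def)
  have last_le: "prob {x. \<forall>k>0. (record_map x ^^ n) k \<noteq> (record_map x ^^ n) 0}
      \<le> prob {x. \<exists>k. (record_map x ^^ n) k = 0}" for n
  proof -
    define Q where "Q = (\<lambda>x i j. (record_map x ^^ n) i = j \<and> (\<forall>k>i. (record_map x ^^ n) k \<noteq> (record_map x ^^ n) i))"
    have Q [measurable]: "Measurable.pred P (\<lambda>x. Q x i j)" for i j
      unfolding Q_def by measurable
    have G: "Measurable.pred P (\<lambda>x. \<exists>k. (record_map x ^^ n) k = 0)" by measurable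
    have all: "(\<forall>k>i. R (k + m)) \<longleftrightarrow> (\<forall>k>i + m. R k)" for i m :: int and R
      by (metis add_less_cancel_right diff_add_cancel)
    have "{x. \<forall>k>0. (record_map x ^^ n) k \<noteq> (record_map x ^^ n) 0} = {x. \<exists>j. Q x 0 j}"
      by (auto simp: Q_def)
    moreover have "emeasure P {x. \<exists>j. Q x 0 j} = emeasure P {x. \<exists>i. Q x i 0}"
    proof (rule mass_transport[OF Q])
      show "Q (rooted_line m x) i j \<longleftrightarrow> Q x (i + m) (j + m)" for m x i j
        using all[of i "\<lambda>k. (record_map x ^^ n) k \<noteq> (record_map x ^^ n) (i + m)" m]
        by (auto simp: Q_def iterated_record_rooted_line)
      show "AE x in P. \<forall>i j. Q x 0 i \<longrightarrow> Q x 0 j \<longrightarrow> i = j" by (simp add: Q_def)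
      \<comment> \<open>A fibre has at most one last element.\<close>
      show "AE x in P. \<forall>i j. Q x i 0 \<longrightarrow> Q x j 0 \<longrightarrow> i = j"
        by (rule AE_I2) (metis Q_def linorder_neqE)
    qed
    moreover have "emeasure P {x. \<exists>i. Q x i 0} \<le> emeasure P {x. \<exists>k. (record_map x ^^ n) k = 0}"
      using G by (intro emeasure_mono) (auto simp: Q_def pred_def)
    ultimately show ?thesis by (simp add: emeasure_eq_measure)
  qed
  have eq_i: "AE x in P. R_perp x 0 > 0"
  proof -
    let ?A = "{x. \<not> R_perp x 0 > 0}"
    have "Measurable.pred P (\<lambda>x. \<not> R_perp x 0 > 0)" by measurable
    then have A: "?A \<in> sets P" by (simp add: pred_def)
    have "prob ?A \<le> prob {x. \<exists>k. (record_map x ^^ n) k = 0}" if "n \<ge> 1" for n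
    proof (rule order.trans[OF _ last_le], rule finite_measure_mono[OF _ set_last], safe)
      fix x k
      assume "\<not> 0 < R_perp x 0" "(0 :: int) < k" "(record_map x ^^ n) k = (record_map x ^^ n) 0"
      then show False using R_perp_eq_iff[of x 0 "R_perp x 0"] that by metis
    qed
    then have "prob ?A \<le> 0"
      by (intro LIMSEQ_le_const[OF iterated_preimage_vanishes]) blast
    then have "?A \<in> null_sets P"
      using A measure_nonneg[of P ?A] by (simp add: null_sets_def emeasure_eq_measure)
    then show ?thesis by (rule AE_I') auto
  qed
  from AE_shift[OF eq_i] show ?thesis
    by (simp add: R_perp_rooted_line)
qed

lemma distr_shift_R_perp: "distr P P (\<lambda>x. rooted_line (R_perp x 0) x) = P"
proof -
  let ?T = "\<lambda>x. rooted_line (R_perp x 0) x"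
  interpret D: prob_space "distr P P ?T"
    by (rule prob_space_distr) measurable
  have le: "emeasure (distr P P ?T) A \<le> emeasure P A" if A [measurable]: "A \<in> sets P" for A
  proof -
    \<comment> \<open>Mass goes from \<open>i\<close> to \<open>R_perp x i\<close> only if the
      sequence seen from there lies in \<open>A\<close>; hence \<open>0\<close> receives mass only
      if \<open>x\<close> is in \<open>A\<close>.\<close>
    define Q where "Q = (\<lambda>x i j. R_perp x i = j \<and> rooted_line j x \<in> A)"
    have Q: "Measurable.pred P (\<lambda>x. Q x i j)" for i j
      unfolding Q_def by measurable
    have "emeasure (distr P P ?T) A = emeasure P {x. \<exists>j. Q x 0 j}"
      by (subst emeasure_distr) (auto simp: Q_def vimage_def)
    also have "\<dots> = emeasure P {x. \<exists>i. Q x i 0}"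
    proof (rule mass_transport[OF Q])
      show "Q (rooted_line m x) i j \<longleftrightarrow> Q x (i + m) (j + m)" for m x i j
        by (auto simp: Q_def R_perp_rooted_line)
      show "AE x in P. \<forall>i j. Q x 0 i \<longrightarrow> Q x 0 j \<longrightarrow> i = j" by (simp add: Q_def)
      show "AE x in P. \<forall>i j. Q x i 0 \<longrightarrow> Q x j 0 \<longrightarrow> i = j"
        using AE_R_perp_greater
        by eventually_elim (metis Q_def R_perp_inj injD)
    qed
    also have "\<dots> \<le> emeasure P A"
      by (rule emeasure_mono) (auto simp: Q_def)
    finally show ?thesis .
  qed
  show ?thesis
  proof (rule measure_eqI)
    fix A assume A: "A \<in> sets (distr P P ?T)"
    \<comment> \<open>Domination on both \<open>A\<close> and its complement, with total mass
      \<open>1\<close> on each side, forces equality.\<close>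
    have "D.prob A \<le> prob A" "D.prob (space P - A) \<le> prob (space P - A)"
      using le[of A] le[of "space P - A"] A sets.compl_sets[of A P]
      by (simp_all add: emeasure_eq_measure D.emeasure_eq_measure)
    moreover have "D.prob (space P - A) = 1 - D.prob A" "prob (space P - A) = 1 - prob A"
      using D.prob_compl[of A] prob_compl[of A] A by simp_all
    ultimately show "emeasure (distr P P ?T) A = emeasure P A"
      by (simp add: emeasure_eq_measure D.emeasure_eq_measure)
  qed simp
qed

end

section \<open>I.i.d. sequences and the conclusion\<close>

text \<open>Used with translations for stationarity, and with injections of the naturals to extract
  the increments on either side of \<open>0\<close>.\<close>

lemma distr_PiM_reindex_const:
  assumes "prob_space \<mu>" "inj g"
  shows "distr (\<Pi>\<^sub>M _\<in>UNIV. \<mu>) (\<Pi>\<^sub>M _\<in>UNIV. \<mu>) (\<lambda>x n. x (g n)) = (\<Pi>\<^sub>M _\<in>UNIV. \<mu>)"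
  using distr_PiM_reindex[of UNIV "\<lambda>_. \<mu>" g UNIV] assms by (simp add: restrict_def)

text \<open>The one-sided descent result is applied to the negated increments to the right of
  \<open>0\<close> for \<open>forward\<close>, and to the increments read leftwards from
  \<open>0\<close> for \<open>backward\<close>. Mean zero and the atom at \<open>-1\<close> provide
  steps of both signs.\<close>

lemma iid_oscillating_sequence:
  fixes \<mu> :: "int measure"
  assumes "prob_space \<mu>" and sets_\<mu>: "sets \<mu> = UNIV"
    and int: "integrable \<mu> real_of_int"
    and mean: "(\<integral>k. real_of_int k \<partial>\<mu>) = 0"
    and neg: "measure \<mu> {-1} > 0"
  shows "oscillating_sequence (\<Pi>\<^sub>M _\<in>UNIV. \<mu>)"
proof -
  interpret \<mu>: prob_space \<mu> by fact
  interpret sequence_space \<mu> ..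
  let ?P = "\<Pi>\<^sub>M _\<in>(UNIV :: int set). \<mu>"
  interpret Z: prob_space ?P by (rule prob_space_PiM) (rule assms(1))
  have space_\<mu>: "space \<mu> = UNIV"
    using sets_\<mu> sets_eq_imp_space_eq[of \<mu> "count_space UNIV"] by simp
  have meas [measurable]: "g \<in> measurable \<mu> (count_space UNIV)" for g :: "int \<Rightarrow> int"
    by (simp add: measurable_def sets_\<mu> space_\<mu>)
  have sets_P: "sets ?P = sets int_seq"
    by (rule sets_PiM_cong) (simp_all add: sets_\<mu>)
  have not_nonneg: "\<not> (AE k in \<mu>. 0 \<le> k)"
  proof
    assume "AE k in \<mu>. 0 \<le> k"
    then have "AE k in \<mu>. k \<notin> {-1}" by eventually_elim auto
    then have "measure \<mu> {-1} = 0"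
      by (subst (asm) AE_iff_measurable[of "{-1}"]) (auto simp: sets_\<mu> space_\<mu> measure_def)
    then show False using neg by simp
  qed
  have not_nonpos: "\<not> (AE k in \<mu>. k \<le> 0)"
  proof
    assume le: "AE k in \<mu>. k \<le> 0"
    have "(\<integral>k. - real_of_int k \<partial>\<mu>) = 0" using mean by simp
    then have "AE k in \<mu>. - real_of_int k = 0"
      using le int by (subst (asm) integral_nonneg_eq_0_iff_AE) auto
    then have "AE k in \<mu>. 0 \<le> k" by eventually_elim simp
    then show False using not_nonneg by simp
  qed
  have transfer: "AE x in ?P. Q (\<lambda>n. x (g n))"
    if "AE y in S. Q y" "inj g" for Q and g :: "nat \<Rightarrow> int"
  proof (rule AE_distrD[where M' = S])
    show "(\<lambda>x n. x (g n)) \<in> measurable ?P S"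
      by (rule measurable_PiM_single') (auto simp: space_PiM space_\<mu>)
    show "AE y in distr ?P S (\<lambda>x n. x (g n)). Q y"
      unfolding distr_PiM_reindex_const[OF \<mu>.prob_space_axioms \<open>inj g\<close>] by fact
  qed
  show ?thesis
  proof
    show "sets ?P = sets int_seq" by (rule sets_P)
    show "distr ?P ?P (rooted_line m) = ?P" for m
      using distr_PiM_reindex_const[of \<mu> "\<lambda>n. n + m"] \<mu>.prob_space_axioms
      by (simp add: rooted_line_def[abs_def] inj_on_def)
    have "AE y in S. \<exists>m. (\<Sum>i<m. - y i) < 0"
      using int mean not_nonneg by (intro AE_walk_below_zero[of uminus]) simp_all
    from transfer[OF this inj_of_nat] show "AE x in ?P. \<exists>j>0. 0 \<le> (\<Sum>l\<in>{0..<j}. x l)"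
    proof eventually_elim
      case (elim x)
      then obtain m where m: "(\<Sum>i<m. - x (int i)) < 0" by auto
      have "(\<Sum>l\<in>{0..<int m}. x l) = (\<Sum>i<m. x (int i))"
        by (rule sum.reindex_bij_witness[of _ int nat]) auto
      \<comment> \<open>A strictly negative sum is not empty, hence
        \<open>int m > 0\<close>.\<close>
      then show ?case using m by (intro exI[of _ "int m"]) (cases m; simp add: sum_negf)
    qed
    have "AE y in S. \<exists>m. (\<Sum>i<m. y i) < 0"
      using int mean not_nonpos by (intro AE_walk_below_zero[of "\<lambda>k. k"]) simp_all
    \<comment> \<open>This injection lists the positions to the left of \<open>0\<close>, starting
      at \<open>-1\<close>.\<close>
    from transfer[OF this, of "\<lambda>n. - int n - 1"]
    have "AE x in ?P. \<exists>m. (\<Sum>i<m. x (- int i - 1)) < 0" by (simp add: inj_on_def)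
    then show "AE x in ?P. \<exists>l<0. (\<Sum>k\<in>{l..<0}. x k) < 0"
    proof eventually_elim
      case (elim x)
      then obtain m where m: "(\<Sum>i<m. x (- int i - 1)) < 0" by auto
      have "(\<Sum>k\<in>{- int m..<0}. x k) = (\<Sum>i<m. x (- int i - 1))"
        by (rule sum.reindex_bij_witness[of _ "\<lambda>i. - int i - 1" "\<lambda>k. nat (- k - 1)"]) auto
      then show ?case using m by (intro exI[of _ "- int m"]) (cases m; simp)
    qed
  qed
qed

theorem proposition56:
  fixes M :: "'a measure" and X :: "int \<Rightarrow> 'a \<Rightarrow> int"
  assumes "prob_space M"
    and "skip_free_left_increments M X"
    and "(\<integral>\<omega>. real_of_int (X 0 \<omega>) \<partial>M) = 0"
  shows "same_distribution M (\<Pi>\<^sub>M n\<in>(UNIV :: int set). count_space (UNIV :: int set))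
           (\<lambda>\<omega>. rooted_line (R_perp (\<lambda>n. X n \<omega>) 0) (\<lambda>n. X n \<omega>))
           (\<lambda>\<omega>. rooted_line 0 (\<lambda>n. X n \<omega>))"
proof -
  interpret prob_space M by fact
  have indep: "indep_vars (\<lambda>_. count_space UNIV) X UNIV"
    and X [measurable]: "X n \<in> measurable M (count_space UNIV)"
    and distr_X: "distr M (count_space UNIV) (X n) = distr M (count_space UNIV) (X 0)"
    and neg: "measure M {\<omega> \<in> space M. X 0 \<omega> = -1} > 0"
    and int: "integrable M (\<lambda>\<omega>. real_of_int (X 0 \<omega>))" for n
    using assms(2) by (auto simp: skip_free_left_increments_def same_distribution_def)
  define \<mu> where "\<mu> = distr M (count_space UNIV) (X 0)"
  have distr_X_eq: "distr M (count_space UNIV) (X n) = \<mu>" for n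
    unfolding \<mu>_def by (rule distr_X)
  define Y where "Y = (\<lambda>\<omega> n. X n \<omega>)"
  let ?P = "\<Pi>\<^sub>M _\<in>(UNIV :: int set). \<mu>"
  let ?T = "\<lambda>x. rooted_line (R_perp x 0) x"
  have Y [measurable]: "Y \<in> measurable M int_seq"
    unfolding Y_def by (rule measurable_PiM_single') auto
  \<comment> \<open>Independence says that the joint law is the product of the marginals, which are
    all \<open>\<mu>\<close>.\<close>
  have distr_Y: "distr M int_seq Y = ?P"
    using indep_vars_iff_distr_eq_PiM[where I = UNIV and M' = "\<lambda>_. count_space UNIV" and X = X] indep
    by (simp add: restrict_def distr_X_eq Y_def)
  interpret seq: oscillating_sequence ?P
  proof (rule iid_oscillating_sequence)
    show "prob_space \<mu>" unfolding \<mu>_def by (rule prob_space_distr) measurable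
    show "sets \<mu> = UNIV" by (simp add: \<mu>_def)
    show "integrable \<mu> real_of_int" using int by (simp add: \<mu>_def integrable_distr_eq)
    show "(\<integral>k. real_of_int k \<partial>\<mu>) = 0" using assms(3) by (simp add: \<mu>_def integral_distr)
    show "measure \<mu> {-1} > 0"
      using neg by (simp add: \<mu>_def measure_distr vimage_def Int_def conj_commute)
  qed
  have "distr M int_seq (\<lambda>\<omega>. ?T (Y \<omega>)) = distr (distr M int_seq Y) int_seq ?T"
    by (simp add: distr_distr comp_def)
  also have "\<dots> = distr ?P ?P ?T"
    by (rule distr_cong) (simp_all add: distr_Y seq.sets_P)
  also have "\<dots> = distr M int_seq Y"
    by (simp add: seq.distr_shift_R_perp distr_Y)
  finally have "same_distribution M int_seq (\<lambda>\<omega>. ?T (Y \<omega>)) Y"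
    unfolding same_distribution_def
    using Y measurable_compose[OF Y measurable_shift_R_perp] by blast
  then show ?thesis
    unfolding Y_def rooted_line_0 .
qed

end
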